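(* Let $k \geq 3$ be an integer. Let $F \subseteq \mathbb{N}$ with $0 \notin F$. Let $(f(n))_{n \geq 0}$ be the characteristic sequence of $F$, and define $f'(n) = \sum_{0 \leq i \leq n} f(i)$. Suppose that $f'(n) = o(n^{\alpha})$ for some real number $\alpha < (k-2)/k$, and let $A = \mathbb{N} \setminus F$. Then the sequence $(r(k,A,n))_{n \geq 0}$ is eventually strictly increasing; that is, there exists $N$ such that $r(k,A,n) > r(k,A,n-1)$ for all $n \geq N$.
   Context: $\mathbb{N} = \{0,1,2,\ldots\}$. The characteristic sequence of a set $F \subseteq \mathbb{N}$ is defined by $f(n) = 1$ if $n \in F$ and $f(n) = 0$ otherwise. For $A \subseteq \mathbb{N}$ and an integer $k \geq 1$, $r(k,A,n)$ denotes the number of $k$-compositions of $n$ with summands in $A$, i.e., the number of ordered $k$-tuples $(c_1,\ldots,c_k) \in A^k$ with $c_1 + \cdots + c_k = n$. The notation $f = o(g)$ means $\lim_{n\to\infty} f(n)/g(n) = 0$. *)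

theory Defs
  imports Complex_Main "HOL-Library.Landau_Symbols" "HOL-Library.Indicator_Function"
begin

definition k_compositions :: "nat \<Rightarrow> nat set \<Rightarrow> nat \<Rightarrow> nat list set" where
  "k_compositions k A n = {c. length c = k \<and> set c \<subseteq> A \<and> sum_list c = n}"

(* Since the summands are natural numbers adding up to n, the set is always finite,
   so card is the true count, also when A contains 0. *)
definition r :: "nat \<Rightarrow> nat set \<Rightarrow> nat \<Rightarrow> nat" where
  "r k A n = card (k_compositions k A n)"

definition char_seq :: "nat set \<Rightarrow> nat \<Rightarrow> nat" where
  "char_seq F n = indicator F n"

definition char_sum :: "nat set \<Rightarrow> nat \<Rightarrow> nat" where
  "char_sum F n = (\<Sum>i=0..n. char_seq F i)"

end

theory Submission
  imports Defs "HOL-Computational_Algebra.Formal_Power_Series"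
begin

text \<open>
  Write \<open>G = 1/(1 - X)\<close> and let \<open>\<Phi>\<close> be the generating function of \<open>F\<close>, so that \<open>A\<close> has generating
  function \<open>G - \<Phi>\<close>. The first differences of \<open>r k A\<close> are the coefficients of
  \<open>(1 - X) (G - \<Phi>)\<^sup>k\<close>, which is the sum over \<open>i\<close> of \<open>(-1)\<^sup>i (k choose i) \<Phi>\<^sup>i G\<^bsup>k-i\<^esup> (1 - X)\<close>.
  The term \<open>i = 0\<close> is \<open>G\<^bsup>k-1\<^esup>\<close>, whose coefficients grow like \<open>n\<^bsup>k-2\<^esup>\<close>. For \<open>i \<ge> 1\<close> the coefficient is at
  most \<open>(k choose i) f'(n)\<^sup>i (n+1)\<^bsup>max(k-2-i, 0)\<^esup>\<close>, which is \<open>o(n\<^bsup>k-2\<^esup>)\<close> because \<open>f'(n) = o(n\<^bsup>(k-2)/k\<^esup>)\<close>;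
  the extreme case is \<open>i = k\<close>.
\<close>

section \<open>Generating functions of sets and the counting function as a coefficient\<close>

definition fps_of_set :: "nat set \<Rightarrow> real fps" where
  "fps_of_set S = Abs_fps (indicator S)"

lemma fps_of_set_nth [simp]: "fps_nth (fps_of_set S) n = indicator S n"
  by (simp add: fps_of_set_def)

definition fps_partial_sum :: "real fps \<Rightarrow> nat \<Rightarrow> real" where
  "fps_partial_sum P n = (\<Sum>i\<le>n. fps_nth P i)"

lemma fps_partial_sum_of_set: "fps_partial_sum (fps_of_set S) n = real (char_sum S n)"
  by (simp add: fps_partial_sum_def char_sum_def char_seq_def indicator_def atMost_atLeast0)

lemma fps_partial_sum_UNIV: "fps_partial_sum (fps_of_set UNIV) n = real n + 1"
  by (simp add: fps_partial_sum_def)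

lemma fps_of_set_UNIV_mult_nth: "fps_nth (P * fps_of_set UNIV) n = fps_partial_sum P n"
  by (simp add: fps_partial_sum_def fps_mult_nth atMost_atLeast0)

lemma fps_of_set_UNIV_mult_one_minus_X: "fps_of_set UNIV * (1 - fps_X) = 1"
  by (rule fps_ext) (simp add: right_diff_distrib)

text \<open>The coefficient formula for powers sums over \<open>natpermute n k\<close>, the lists of
  length \<open>k\<close> with sum \<open>n\<close>. Each list contributes a product of indicators,
  which is 1 exactly when all entries lie in \<open>S\<close>. That formula covers only exponents
  \<open>Suc m\<close>, hence the separate case \<open>k = 0\<close>.\<close>

lemma r_eq_fps_power_nth: "real (r k S n) = fps_nth (fps_of_set S ^ k) n"
proof (cases k)
  case 0
  then have "k_compositions k S n = (if n = 0 then {[]} else {})"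
    by (auto simp: k_compositions_def)
  with 0 show ?thesis by (simp add: r_def)
next
  case (Suc m)
  have fin: "finite (natpermute n k)" by (rule natpermute_finite)
  have "fps_nth (fps_of_set S ^ k) n =
      (\<Sum>v\<in>natpermute n k. \<Prod>j = 0..m. indicator S (v ! j))"
    using fps_power_nth_Suc[of "fps_of_set S" m n] by (simp only: Suc fps_of_set_nth Suc_eq_plus1)
  also have "\<dots> = (\<Sum>v\<in>natpermute n k. if set v \<subseteq> S then 1 else 0)"
  proof (rule sum.cong[OF refl])
    fix v assume "v \<in> natpermute n k"
    then have len: "length v = Suc m" by (simp add: natpermute_def Suc)
    then have "set v \<subseteq> S \<longleftrightarrow> (\<forall>j\<in>{0..m}. v ! j \<in> S)"
      by (fastforce simp: in_set_conv_nth less_Suc_eq_le)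
    then show "(\<Prod>j = 0..m. indicator S (v ! j)) = (if set v \<subseteq> S then 1 else 0 :: real)"
      by (auto simp: indicator_def prod_zero_iff)
  qed
  also have "\<dots> = real (card {v \<in> natpermute n k. set v \<subseteq> S})"
    using fin by (simp add: sum.If_cases Int_def)
  also have "{v \<in> natpermute n k. set v \<subseteq> S} = k_compositions k S n"
    by (auto simp: natpermute_def k_compositions_def)
  finally show ?thesis by (simp add: r_def)
qed

section \<open>Series with nonnegative coefficients\<close>

definition fps_nonneg :: "real fps \<Rightarrow> bool" where
  "fps_nonneg P \<longleftrightarrow> (\<forall>n. 0 \<le> fps_nth P n)"

lemma fps_nonneg_of_set: "fps_nonneg (fps_of_set S)"
  by (simp add: fps_nonneg_def)

lemma fps_nonneg_mult: "fps_nonneg P \<Longrightarrow> fps_nonneg Q \<Longrightarrow> fps_nonneg (P * Q)"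
  by (simp add: fps_nonneg_def fps_mult_nth sum_nonneg)

lemma fps_nonneg_power: "fps_nonneg P \<Longrightarrow> fps_nonneg (P ^ m)"
  by (induction m) (auto intro: fps_nonneg_mult simp: fps_nonneg_def[of 1])

lemma fps_partial_sum_nonneg: "fps_nonneg P \<Longrightarrow> 0 \<le> fps_partial_sum P n"
  by (simp add: fps_nonneg_def fps_partial_sum_def sum_nonneg)

lemma fps_nth_le_partial_sum:
  assumes "fps_nonneg P" "m \<le> n"
  shows "fps_nth P m \<le> fps_partial_sum P n"
  unfolding fps_partial_sum_def
  using assms by (intro member_le_sum) (auto simp: fps_nonneg_def)

text \<open>The left side sums over the triangle i + j \<le> n, the right side over the square i, j
  \<le> n. Nonnegativity makes the extra terms harmless.\<close>

lemma fps_partial_sum_mult_le: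
  assumes "fps_nonneg P" "fps_nonneg Q"
  shows "fps_partial_sum (P * Q) n \<le> fps_partial_sum P n * fps_partial_sum Q n"
proof -
  have "fps_partial_sum (P * Q) n = (\<Sum>m\<le>n. \<Sum>i\<le>m. fps_nth P i * fps_nth Q (m - i))"
    by (simp add: fps_partial_sum_def fps_mult_nth atMost_atLeast0)
  also have "\<dots> = (\<Sum>(i, j)\<in>{(i, j). i + j \<le> n}. fps_nth P i * fps_nth Q j)"
    by (simp add: sum.triangle_reindex_eq)
  also have "\<dots> \<le> (\<Sum>(i, j)\<in>{..n} \<times> {..n}. fps_nth P i * fps_nth Q j)"
    using assms by (intro sum_mono2) (auto simp: fps_nonneg_def)
  also have "\<dots> = fps_partial_sum P n * fps_partial_sum Q n"
    by (simp add: fps_partial_sum_def sum_product sum.cartesian_product)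
  finally show ?thesis .
qed

lemma fps_partial_sum_power_le:
  assumes "fps_nonneg P"
  shows "fps_partial_sum (P ^ m) n \<le> fps_partial_sum P n ^ m"
proof (induction m)
  case 0
  show ?case by (simp add: fps_partial_sum_def)
next
  case (Suc m)
  have "fps_partial_sum (P ^ Suc m) n \<le> fps_partial_sum P n * fps_partial_sum (P ^ m) n"
    using fps_partial_sum_mult_le assms fps_nonneg_power by simp
  also have "\<dots> \<le> fps_partial_sum P n * fps_partial_sum P n ^ m"
    using Suc fps_partial_sum_nonneg[OF assms] by (intro mult_left_mono)
  finally show ?case by simp
qed

section \<open>Coefficients of powers of 1/(1 - X)\<close>

lemma fps_of_set_UNIV_power_nth: "fps_nth (fps_of_set UNIV ^ Suc m) n = real ((n + m) choose m)"
proof (induction m arbitrary: n)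
  case 0
  show ?case by simp
next
  case (Suc m)
  have "fps_nth (fps_of_set UNIV ^ Suc (Suc m)) n =
      fps_partial_sum (fps_of_set UNIV ^ Suc m) n"
    by (metis fps_of_set_UNIV_mult_nth power_Suc2)
  also have "\<dots> = real (\<Sum>i\<le>n. (m + i) choose m)"
    unfolding fps_partial_sum_def Suc by (simp add: add.commute)
  \<comment> \<open>Hockey-stick identity.\<close>
  also have "(\<Sum>i\<le>n. (m + i) choose m) = (n + Suc m) choose Suc m"
    using choose_rising_sum(1)[of m n] by (simp add: add.commute)
  finally show ?case .
qed

lemma power_le_fps_of_set_UNIV_power_nth:
  assumes "m > 0"
  shows "(real n / real m) ^ m \<le> fps_nth (fps_of_set UNIV ^ Suc m) n"
proof -
  have "(real n / real m) ^ m \<le> (real (n + m) / real m) ^ m"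
    by (intro power_mono divide_right_mono) auto
  also have "\<dots> \<le> real ((n + m) choose m)"
    using binomial_ge_n_over_k_pow_k[of m "n + m", where 'a = real] by simp
  finally show ?thesis unfolding fps_of_set_UNIV_power_nth .
qed

text \<open>Truncated subtraction is intended: the exponent of \<open>real n + 1\<close> is \<open>0\<close> for \<open>i \<ge> k - 2\<close>.\<close>

lemma abs_mixed_term_le:
  assumes "fps_nonneg P" "i \<le> k"
  shows "\<bar>fps_nth (P ^ i * fps_of_set UNIV ^ (k - i) * (1 - fps_X)) n\<bar>
    \<le> fps_partial_sum P n ^ i * (real n + 1) ^ (k - 2 - i)"
proof -
  let ?G = "fps_of_set UNIV"
  note nonneg = fps_nonneg_power[OF assms(1)] fps_nonneg_power[OF fps_nonneg_of_set]
  have nth_le: "fps_nth (P ^ i) m \<le> fps_partial_sum P n ^ i" if "m \<le> n" for m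
    using fps_nth_le_partial_sum[OF nonneg(1) that] fps_partial_sum_power_le[OF assms(1)]
    by (rule order_trans)
  have nth_ge: "0 \<le> fps_nth (P ^ i) m" for m
    using nonneg(1) by (simp add: fps_nonneg_def)
  have cancel: "P ^ i * ?G ^ Suc j * (1 - fps_X) = P ^ i * ?G ^ j" for j
    using fps_of_set_UNIV_mult_one_minus_X by (simp add: mult.assoc mult.left_commute)
  \<comment> \<open>The cases count the factors \<open>?G\<close> available to absorb 1 - X. With
    none, a difference of neighbouring coefficients of \<open>P ^ i\<close> remains; with one, the
    cancellation is exact; with more, one factor cancels and another turns coefficients into partial
    sums, which are submultiplicative.\<close>
  consider "k - i = 0" | "k - i = 1" | j where "k - i = Suc (Suc j)"
    by (metis One_nat_def old.nat.exhaust)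
  then show ?thesis
  proof cases
    case 1
    \<comment> \<open>Both coefficients lie between 0 and the bound, so their difference costs no
      factor 2.\<close>
    have "\<bar>fps_nth (P ^ i) n - fps_nth (P ^ i) (n - 1)\<bar> \<le> fps_partial_sum P n ^ i"
      using nth_le[of n] nth_le[of "n - 1"] nth_ge[of n] nth_ge[of "n - 1"] by linarith
    \<comment> \<open>Needed for n = 0, where nothing is subtracted although \<open>n - 1\<close>
      truncates to 0.\<close>
    moreover have "\<bar>fps_nth (P ^ i) n\<bar> \<le> fps_partial_sum P n ^ i"
      using nth_le[of n] nth_ge[of n] by linarith
    ultimately show ?thesis
      using 1 by (cases "n = 0") (simp_all add: right_diff_distrib)
  next
    case 2
    then have "P ^ i * ?G ^ (k - i) * (1 - fps_X) = P ^ i"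
      using cancel[of 0] by (simp only: power_one_right power_0 mult_1_right flip: One_nat_def)
    with 2 have "?thesis \<longleftrightarrow> \<bar>fps_nth (P ^ i) n\<bar> \<le> fps_partial_sum P n ^ i"
      by (simp only:) simp
    then show ?thesis
      using nth_le[of n] nth_ge[of n] by simp
  next
    case (3 j)
    have eq: "P ^ i * ?G ^ (k - i) * (1 - fps_X) = P ^ i * ?G ^ j * ?G"
      using cancel[of "Suc j"] 3 by (simp add: mult_ac)
    have "k - 2 - i = j" using 3 by simp
    moreover have "fps_partial_sum (P ^ i * ?G ^ j) n \<le> fps_partial_sum P n ^ i * (real n + 1) ^ j"
    proof -
      have "fps_partial_sum (P ^ i * ?G ^ j) n \<le> fps_partial_sum (P ^ i) n * fps_partial_sum (?G ^ j) n"
        by (intro fps_partial_sum_mult_le nonneg)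
      also have "\<dots> \<le> fps_partial_sum P n ^ i * fps_partial_sum ?G n ^ j"
        by (intro mult_mono fps_partial_sum_power_le fps_partial_sum_nonneg zero_le_power
            nonneg assms fps_nonneg_of_set)
      finally show ?thesis by (simp add: fps_partial_sum_UNIV)
    qed
    moreover have "0 \<le> fps_partial_sum (P ^ i * ?G ^ j) n"
      by (intro fps_partial_sum_nonneg fps_nonneg_mult nonneg)
    ultimately show ?thesis
      by (simp add: eq fps_of_set_UNIV_mult_nth)
  qed
qed

section \<open>Asymptotic size of the bounds\<close>

lemma smallo_powr_power:
  fixes f :: "nat \<Rightarrow> real"
  assumes "f \<in> o(\<lambda>n. real n powr \<gamma>)" "i > 0"
  shows "(\<lambda>n. f n ^ i) \<in> o(\<lambda>n. real n powr (\<gamma> * real i))"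
proof -
  \<comment> \<open>At n = 0 both sides are 0: \<open>0 powr x\<close> is 0 for every x, and i >
    0.\<close>
  have "(real n powr \<gamma>) ^ i = real n powr (\<gamma> * real i)" for n
    using assms(2) by (cases "n = 0") (simp_all add: powr_power mult.commute)
  with landau_o.small_power[OF assms] show ?thesis by simp
qed

lemma smallo_mixed_bound:
  fixes f :: "nat \<Rightarrow> real"
  assumes k: "k \<ge> 3" and i: "1 \<le> i" "i \<le> k"
    and f: "f \<in> o(\<lambda>n. real n powr ((real k - 2) / real k))"
  shows "(\<lambda>n. f n ^ i * (real n + 1) ^ (k - 2 - i)) \<in> o(\<lambda>n. real n ^ (k - 2))"
proof -
  let ?\<gamma> = "(real k - 2) / real k"
  have "(\<lambda>n. real n + 1) \<in> O(\<lambda>n. real n)"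
    by (rule bigoI[of _ 2]) (auto intro!: eventually_sequentiallyI[of 1])
  then have "(\<lambda>n. (real n + 1) ^ (k - 2 - i)) \<in> O(\<lambda>n. real n ^ (k - 2 - i))"
    by (rule landau_o.big_power)
  with smallo_powr_power[OF f, of i] i
  have 1: "(\<lambda>n. f n ^ i * (real n + 1) ^ (k - 2 - i))
      \<in> o(\<lambda>n. real n powr (?\<gamma> * real i) * real n ^ (k - 2 - i))"
    by (intro landau_o.small_big_mult) auto
  \<comment> \<open>For i \<le> k - 2, ?\<gamma> \<le> 1 suffices. For larger i the truncated
    exponent is 0 and ?\<gamma> * i \<le> ?\<gamma> * k = k - 2, with equality at i = k; this is
    where the threshold (k - 2)/k comes from.\<close>
  have exponent: "?\<gamma> * real i + real (k - 2 - i) \<le> real (k - 2)"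
  proof (cases "i \<le> k - 2")
    case True
    have "?\<gamma> * real i \<le> 1 * real i"
      using k by (intro mult_right_mono) (auto simp: field_simps)
    with True show ?thesis by (simp add: of_nat_diff)
  next
    case False
    have "?\<gamma> * real i \<le> ?\<gamma> * real k"
      using k i by (intro mult_left_mono) auto
    with False k show ?thesis by (simp add: of_nat_diff)
  qed
  have "(\<lambda>n. real n powr (?\<gamma> * real i) * real n ^ (k - 2 - i)) \<in> O(\<lambda>n. real n ^ (k - 2))"
  proof (rule bigoI[of _ 1], rule eventually_sequentiallyI[of 1])
    fix n :: nat assume n: "1 \<le> n"
    have "real n powr (?\<gamma> * real i) * real n ^ (k - 2 - i)
        = real n powr (?\<gamma> * real i + real (k - 2 - i))"
      using n by (simp add: powr_add powr_realpow)
    also have "\<dots> \<le> real n powr real (k - 2)"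
      using n exponent by (intro powr_mono) auto
    finally show "norm (real n powr (?\<gamma> * real i) * real n ^ (k - 2 - i)) \<le> 1 * norm (real n ^ (k - 2))"
      using n by (simp add: powr_realpow)
  qed
  with 1 show ?thesis by (rule landau_o.small_big_trans)
qed

section \<open>Expansion of the first differences and conclusion\<close>

lemma first_difference_expansion:
  "fps_of_set (UNIV - F) ^ k * (1 - fps_X) =
    (\<Sum>i\<le>k. fps_const ((-1) ^ i * real (k choose i)) *
      (fps_of_set F ^ i * fps_of_set UNIV ^ (k - i) * (1 - fps_X)))"
proof -
  have "fps_of_set (UNIV - F) = - fps_of_set F + fps_of_set UNIV"
    by (rule fps_ext) (simp add: indicator_def)
  then have "fps_of_set (UNIV - F) ^ k =
      (\<Sum>i\<le>k. of_nat (k choose i) * (- fps_of_set F) ^ i * fps_of_set UNIV ^ (k - i))"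
    by (simp only: binomial_ring)
  moreover have "of_nat (k choose i) * (- fps_of_set F) ^ i =
      fps_const ((-1) ^ i * real (k choose i)) * fps_of_set F ^ i" for i
    by (cases "even i") (simp_all add: fps_of_nat flip: fps_const_neg)
  ultimately show ?thesis
    by (simp add: sum_distrib_right mult.assoc)
qed

theorem theorem1:
  fixes k :: nat and F A :: "nat set" and \<alpha> :: real
  assumes "k \<ge> 3"
    and "0 \<notin> F"
    and "\<alpha> < (real k - 2) / real k"
    and "(\<lambda>n. real (char_sum F n)) \<in> o(\<lambda>n. real n powr \<alpha>)"
    and "A = UNIV - F"
  shows "\<exists>N\<ge>1. \<forall>n\<ge>N. r k A n > r k A (n - 1)"
proof -
  let ?G = "fps_of_set UNIV" and ?m = "k - 2"
  define T where "T i n = fps_nth (fps_of_set F ^ i * ?G ^ (k - i) * (1 - fps_X)) n" for i n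
  define rest where "rest n = (\<Sum>i=1..k. (-1) ^ i * real (k choose i) * T i n)" for n
  \<comment> \<open>Chosen so that \<open>c * real n ^ ?m\<close> is (n / ?m)^?m, the lower bound
    for the main coefficient.\<close>
  define c where "c = 1 / real ?m ^ ?m"
  have c: "c > 0" using assms(1) by (simp add: c_def)

  have "(\<lambda>n. real n powr \<alpha>) \<in> O(\<lambda>n. real n powr ((real k - 2) / real k))"
    using assms(3)
    by (intro bigoI[of _ 1] eventually_sequentiallyI[of 1]) (auto intro: powr_mono)
  with assms(4) have f: "(\<lambda>n. real (char_sum F n)) \<in> o(\<lambda>n. real n powr ((real k - 2) / real k))"
    by (rule landau_o.small_big_trans)

  have "T i \<in> o(\<lambda>n. real n ^ ?m)" if i: "i \<in> {1..k}" for i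
  proof (rule landau_o.big_small_trans)
    show "T i \<in> O(\<lambda>n. real (char_sum F n) ^ i * (real n + 1) ^ (k - 2 - i))"
      unfolding T_def using i
        abs_mixed_term_le[OF fps_nonneg_of_set, of i k F, unfolded fps_partial_sum_of_set]
      by (intro bigoI[of _ 1] always_eventually) auto
    show "(\<lambda>n. real (char_sum F n) ^ i * (real n + 1) ^ (k - 2 - i)) \<in> o(\<lambda>n. real n ^ ?m)"
      using i by (intro smallo_mixed_bound f assms(1)) auto
  qed
  then have "rest \<in> o(\<lambda>n. real n ^ ?m)"
    unfolding rest_def by (intro big_sum_in_smallo landau_o.small.cmult_in_iff') auto
  \<comment> \<open>Allowing the error only half of the main term's lower bound leaves a positive
    remainder.\<close>
  then have "eventually (\<lambda>n. norm (rest n) \<le> (c / 2) * norm (real n ^ ?m)) sequentially"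
    using c by (intro landau_o.smallD) auto
  then obtain N where N: "\<And>n. n \<ge> N \<Longrightarrow> \<bar>rest n\<bar> \<le> (c / 2) * real n ^ ?m"
    by (auto simp: eventually_sequentially)

  have difference: "real (r k A n) - real (r k A (n - 1)) = T 0 n + rest n" if "n \<ge> 1" for n
  proof -
    have "real (r k A n) - real (r k A (n - 1)) = fps_nth (fps_of_set A ^ k * (1 - fps_X)) n"
      using that by (simp add: r_eq_fps_power_nth right_diff_distrib)
    also have "\<dots> = (\<Sum>i\<le>k. (-1) ^ i * real (k choose i) * T i n)"
      by (simp add: assms(5) first_difference_expansion fps_sum_nth T_def)
    also have "\<dots> = T 0 n + rest n"
      by (simp add: rest_def atMost_atLeast0 sum.atLeast_Suc_atMost)
    finally show ?thesis .
  qed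

  have main_term: "c * real n ^ ?m \<le> T 0 n" for n
  proof -
    have "k = Suc (Suc ?m)" using assms(1) by simp
    then have "?G ^ k * (1 - fps_X) = ?G ^ Suc ?m"
      by (metis fps_of_set_UNIV_mult_one_minus_X mult.assoc mult.right_neutral power_Suc2)
    then show ?thesis
      using power_le_fps_of_set_UNIV_power_nth[of ?m n] assms(1)
      by (simp add: T_def c_def power_divide)
  qed

  \<comment> \<open>The maximum with 1 makes \<open>n - 1\<close> the true predecessor and
    \<open>real n ^ ?m\<close> positive.\<close>
  have "r k A n > r k A (n - 1)" if n: "n \<ge> max N 1" for n
  proof -
    have "0 < (c / 2) * real n ^ ?m" using c n by simp
    moreover have "\<bar>rest n\<bar> \<le> (c / 2) * real n ^ ?m" using N n by simp
    ultimately have "0 < T 0 n + rest n" using main_term[of n] by linarith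
    with difference[of n] n show ?thesis by simp
  qed
  then show ?thesis by (intro exI[of _ "max N 1"]) auto
qed

end
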